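(* Let $p\in[1,\infty]$, and let $E$ be a locally convex space. Then every bounded subset of $E$ is a $p$-$(V^\ast)$ set (equivalently, the family of all bounded subsets of $E$ coincides with the family of all $p$-$(V^\ast)$ sets in $E$) if and only if the strong dual $E'_\beta$ has the $p$-Schur property.
   Context: All locally convex spaces are Hausdorff, over $\mathbb{F}\in\{\mathbb{R},\mathbb{C}\}$. $E'$ is the topological dual of $E$, and $E'_\beta$ is $E'$ with the strong topology $\beta(E',E)$ (uniform convergence on bounded subsets of $E$). A sequence $\{x_n\}_{n\in\omega}$ in a locally convex space $F$ is weakly $p$-summable if $(\langle\chi,x_n\rangle)_n\in\ell_p$ (or $\in c_0$ if $p=\infty$) for every $\chi\in F'$. A non-empty subset $A$ of $E$ is a $p$-$(V^\ast)$ set if $\lim_{n\to\infty}\sup_{a\in A}|\langle\chi_n,a\rangle|=0$ for every weakly $p$-summable sequence $\{\chi_n\}_{n\in\omega}$ in $E'_\beta$ (such sets are always bounded). A locally convex space has the $p$-Schur property if every weakly $p$-summable sequence in it converges to zero. *)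

theory Defs
  imports "HOL-Analysis.Analysis" "HOL-Library.Function_Algebras"
begin

text \<open>
  The scalar fields: \<open>h\<close> identifies the normed field \<open>'a\<close> isometrically with the real
  or with the complex numbers.
\<close>

class real_or_complex = real_normed_field +
  assumes real_or_complex:
    "\<exists>h :: 'a \<Rightarrow> complex.
       (\<forall>x y. h (x + y) = h x + h y) \<and> (\<forall>x y. h (x * y) = h x * h y) \<and>
       (\<forall>r x. h (r *\<^sub>R x) = r *\<^sub>R h x) \<and> (\<forall>x. norm (h x) = norm x) \<and>
       (range h = \<real> \<or> range h = UNIV)"

instance real :: real_or_complex
proof
  show "\<exists>h :: real \<Rightarrow> complex.
       (\<forall>x y. h (x + y) = h x + h y) \<and> (\<forall>x y. h (x * y) = h x * h y) \<and>
       (\<forall>r x. h (r *\<^sub>R x) = r *\<^sub>R h x) \<and> (\<forall>x. norm (h x) = norm x) \<and>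
       (range h = \<real> \<or> range h = UNIV)"
    by (rule exI [of _ complex_of_real]) (simp add: Reals_def scaleR_conv_of_real)
qed

instance complex :: real_or_complex
proof
  show "\<exists>h :: complex \<Rightarrow> complex.
       (\<forall>x y. h (x + y) = h x + h y) \<and> (\<forall>x y. h (x * y) = h x * h y) \<and>
       (\<forall>r x. h (r *\<^sub>R x) = r *\<^sub>R h x) \<and> (\<forall>x. norm (h x) = norm x) \<and>
       (range h = \<real> \<or> range h = UNIV)"
    by (rule exI [of _ "\<lambda>x. x"]) simp
qed

text \<open>
  The space is the carrier \<open>topspace T\<close>, a linear subspace of the ambient vector space
  \<open>'v\<close>; in this way a space and its dual are instances of the same notion.
\<close>

locale locally_convex_space = vector_space smul
  for smul :: "'k::real_or_complex \<Rightarrow> 'v::ab_group_add \<Rightarrow> 'v" +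
  fixes T :: "'v topology"
  assumes subspace_topspace: "subspace (topspace T)"
    and Hausdorff: "Hausdorff_space T"
    and continuous_add: "continuous_map (prod_topology T T) T (\<lambda>(x, y). x + y)"
    and continuous_scale: "continuous_map (prod_topology euclidean T) T (\<lambda>(c, x). smul c x)"
    and locally_convex:
      "\<And>U. openin T U \<Longrightarrow> 0 \<in> U \<Longrightarrow>
         \<exists>V. openin T V \<and> 0 \<in> V \<and> V \<subseteq> U \<and>
           (\<forall>x\<in>V. \<forall>y\<in>V. \<forall>u\<ge>0. \<forall>v\<ge>0. u + v = 1 \<longrightarrow>
              smul (of_real u) x + smul (of_real v) y \<in> V)"

definition bounded_in ::
  "('k::real_normed_field \<Rightarrow> 'v::ab_group_add \<Rightarrow> 'v) \<Rightarrow> 'v topology \<Rightarrow> 'v set \<Rightarrow> bool"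
where
  "bounded_in smul T A \<longleftrightarrow> A \<subseteq> topspace T \<and>
     (\<forall>U. openin T U \<and> 0 \<in> U \<longrightarrow> (\<exists>r. \<forall>c. r < norm c \<longrightarrow> A \<subseteq> smul c ` U))"

text \<open>
  Functionals are only meaningful on \<open>topspace T\<close>. They are required to vanish elsewhere so
  that each of them is represented by exactly one function and pointwise addition and
  multiplication by scalars stay inside the dual.
\<close>

definition dual_space ::
  "('k::real_normed_field \<Rightarrow> 'v::ab_group_add \<Rightarrow> 'v) \<Rightarrow> 'v topology \<Rightarrow> ('v \<Rightarrow> 'k) set"
where
  "dual_space smul T = {f. continuous_map T euclidean f \<and>
     (\<forall>x\<in>topspace T. \<forall>y\<in>topspace T. f (x + y) = f x + f y) \<and>
     (\<forall>c. \<forall>x\<in>topspace T. f (smul c x) = c * f x) \<and>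
     (\<forall>x. x \<notin> topspace T \<longrightarrow> f x = 0)}"

definition dual_smul :: "'k::real_normed_field \<Rightarrow> ('v \<Rightarrow> 'k) \<Rightarrow> 'v \<Rightarrow> 'k" where
  "dual_smul c f = (\<lambda>x. c * f x)"

definition strong_open ::
  "('k::real_normed_field \<Rightarrow> 'v::ab_group_add \<Rightarrow> 'v) \<Rightarrow> 'v topology \<Rightarrow> ('v \<Rightarrow> 'k) set \<Rightarrow> bool"
where
  "strong_open smul T W \<longleftrightarrow> W \<subseteq> dual_space smul T \<and>
     (\<forall>f\<in>W. \<exists>A e. bounded_in smul T A \<and> e > 0 \<and>
        {g \<in> dual_space smul T. \<forall>x\<in>A. norm (g x - f x) \<le> e} \<subseteq> W)"

definition strong_dual ::
  "('k::real_normed_field \<Rightarrow> 'v::ab_group_add \<Rightarrow> 'v) \<Rightarrow> 'v topology \<Rightarrow> ('v \<Rightarrow> 'k) topology"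
where
  "strong_dual smul T = topology (strong_open smul T)"

lemma bounded_in_empty: "bounded_in smul T {}"
  by (simp add: bounded_in_def)

lemma bounded_in_Un:
  assumes "bounded_in smul T A" "bounded_in smul T B"
  shows "bounded_in smul T (A \<union> B)"
  unfolding bounded_in_def
proof (intro conjI allI impI)
  show "A \<union> B \<subseteq> topspace T"
    using assms by (auto simp: bounded_in_def)
  fix U assume U: "openin T U \<and> 0 \<in> U"
  obtain r where r: "\<And>c. r < norm c \<Longrightarrow> A \<subseteq> smul c ` U"
    using assms(1) U unfolding bounded_in_def by metis
  obtain s where s: "\<And>c. s < norm c \<Longrightarrow> B \<subseteq> smul c ` U"
    using assms(2) U unfolding bounded_in_def by metis
  have "A \<union> B \<subseteq> smul c ` U" if "max r s < norm c" for c
    using r [of c] s [of c] that by auto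
  then show "\<exists>r. \<forall>c. r < norm c \<longrightarrow> A \<union> B \<subseteq> smul c ` U"
    by blast
qed

lemma istopology_strong_open: "istopology (strong_open smul T)"
  unfolding istopology_def
proof (intro conjI allI impI)
  fix S W assume SW: "strong_open smul T S" "strong_open smul T W"
  show "strong_open smul T (S \<inter> W)"
    unfolding strong_open_def
  proof (intro conjI ballI)
    show "S \<inter> W \<subseteq> dual_space smul T"
      using SW by (auto simp: strong_open_def)
    fix f assume f: "f \<in> S \<inter> W"
    obtain A a where A: "bounded_in smul T A" "a > 0"
      "{g \<in> dual_space smul T. \<forall>x\<in>A. norm (g x - f x) \<le> a} \<subseteq> S"
      using SW(1) f unfolding strong_open_def by blast
    obtain B b where B: "bounded_in smul T B" "b > 0"
      "{g \<in> dual_space smul T. \<forall>x\<in>B. norm (g x - f x) \<le> b} \<subseteq> W"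
      using SW(2) f unfolding strong_open_def by blast
    have "{g \<in> dual_space smul T. \<forall>x\<in>A \<union> B. norm (g x - f x) \<le> min a b} \<subseteq> S \<inter> W"
      using A(3) B(3) by auto
    then show "\<exists>A e. bounded_in smul T A \<and> e > 0 \<and>
        {g \<in> dual_space smul T. \<forall>x\<in>A. norm (g x - f x) \<le> e} \<subseteq> S \<inter> W"
      using bounded_in_Un [OF A(1) B(1)] A(2) B(2)
      by (intro exI [of _ "A \<union> B"] exI [of _ "min a b"]) auto
  qed
next
  fix K assume K: "\<forall>W\<in>K. strong_open smul T W"
  show "strong_open smul T (\<Union>K)"
    unfolding strong_open_def
  proof (intro conjI ballI)
    show "\<Union>K \<subseteq> dual_space smul T"
      using K by (auto simp: strong_open_def)
    fix f assume "f \<in> \<Union>K"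
    then obtain W where W: "W \<in> K" "f \<in> W"
      by blast
    then obtain A a where "bounded_in smul T A" "a > 0"
      "{g \<in> dual_space smul T. \<forall>x\<in>A. norm (g x - f x) \<le> a} \<subseteq> W"
      using K unfolding strong_open_def by blast
    with W(1) show "\<exists>A e. bounded_in smul T A \<and> e > 0 \<and>
        {g \<in> dual_space smul T. \<forall>x\<in>A. norm (g x - f x) \<le> e} \<subseteq> \<Union>K"
      by blast
  qed
qed

lemma openin_strong_dual: "openin (strong_dual smul T) W \<longleftrightarrow> strong_open smul T W"
  by (simp add: strong_dual_def istopology_strong_open topology_inverse')

lemma topspace_strong_dual: "topspace (strong_dual smul T) = dual_space smul T"
proof -
  have "strong_open smul T (dual_space smul T)"
    unfolding strong_open_def
    using bounded_in_empty by (auto intro!: exI [of _ "{}"] exI [of _ "1::real"])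
  then show ?thesis
    unfolding topspace_def openin_strong_dual by (auto simp: strong_open_def)
qed

definition in_ell :: "ennreal \<Rightarrow> (nat \<Rightarrow> 'k::real_normed_field) \<Rightarrow> bool" where
  "in_ell p a \<longleftrightarrow>
     (if p = \<infinity> then a \<longlonglongrightarrow> 0 else summable (\<lambda>n. norm (a n) powr enn2real p))"

definition weakly_p_summable ::
  "ennreal \<Rightarrow> ('k::real_normed_field \<Rightarrow> 'v::ab_group_add \<Rightarrow> 'v) \<Rightarrow> 'v topology \<Rightarrow> (nat \<Rightarrow> 'v) \<Rightarrow> bool"
where
  "weakly_p_summable p smul T x \<longleftrightarrow>
     (\<forall>n. x n \<in> topspace T) \<and> (\<forall>\<phi>\<in>dual_space smul T. in_ell p (\<lambda>n. \<phi> (x n)))"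

text \<open>
  The supremum is taken in \<^typ>\<open>ennreal\<close> because it may be infinite: boundedness of \<open>A\<close>
  is a consequence of the definition, not part of it.
\<close>

definition p_V_star_set ::
  "ennreal \<Rightarrow> ('k::real_normed_field \<Rightarrow> 'v::ab_group_add \<Rightarrow> 'v) \<Rightarrow> 'v topology \<Rightarrow> 'v set \<Rightarrow> bool"
where
  "p_V_star_set p smul T A \<longleftrightarrow> A \<noteq> {} \<and> A \<subseteq> topspace T \<and>
     (\<forall>\<phi>. weakly_p_summable p dual_smul (strong_dual smul T) \<phi> \<longrightarrow>
        (\<lambda>n. SUP a\<in>A. ennreal (norm (\<phi> n a))) \<longlonglongrightarrow> 0)"

definition p_Schur ::
  "ennreal \<Rightarrow> ('k::real_normed_field \<Rightarrow> 'v::ab_group_add \<Rightarrow> 'v) \<Rightarrow> 'v topology \<Rightarrow> bool"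
where
  "p_Schur p smul T \<longleftrightarrow>
     (\<forall>x. weakly_p_summable p smul T x \<longrightarrow> limitin T x 0 sequentially)"

end

theory Submission
  imports Defs
begin

text \<open>
  The first equivalence is a matter of unfolding: a sequence of functionals tends to zero in the
  strong dual exactly when its suprema over each non-empty bounded set tend to zero
  (\<open>limitin_strong_dual_zero_iff\<close>), so exchanging the quantifiers over bounded sets and over weakly
  $p$-summable sequences turns one side into the other (\<open>bounded_sets_p_V_star_iff_p_Schur\<close>).

  The second equivalence follows once every $p$-$(V^*)$ set \<open>A\<close> is known to be bounded. For a continuous
  functional \<open>f\<close>, the sequence \<open>2\<^sup>-\<^sup>n f\<close> is weakly $p$-summable because any functional maps it to a
  geometric sequence; if \<open>f\<close> were unbounded on \<open>A\<close>, all the suprema over \<open>A\<close> would be infinite. Hence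
  \<open>A\<close> is weakly bounded (\<open>p_V_star_set_weakly_bounded\<close>), and it remains to apply Mackey's
  theorem that weakly bounded sets are bounded (\<open>bounded_in_if_weakly_bounded\<close>).

  Mackey's theorem is obtained without passing through a Banach space. If a continuous seminorm \<open>q\<close>
  is unbounded on \<open>A\<close>, choose \<open>a\<^sub>n\<close> in \<open>A\<close> with \<open>q a\<^sub>n > 2 n 3\<^sup>n\<close> and, by the Hahn-Banach theorem
  (\<open>norming_functional\<close>), real-linear \<open>f\<^sub>n\<close> with \<open>\<bar>f\<^sub>n\<bar> \<le> q\<close> and \<open>f\<^sub>n a\<^sub>n = q a\<^sub>n\<close>. A series
  \<open>\<Sum>n. \<plusminus> 3\<^sup>-\<^sup>n f\<^sub>n\<close> with suitably chosen signs is dominated by a multiple of \<open>q\<close> and unbounded on \<open>A\<close>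
  (\<open>unbounded_functional\<close>). It is the real part of a continuous functional
  (\<open>dual_functional_dominating\<close>), which contradicts weak boundedness.
\<close>

section \<open>The Hahn-Banach theorem for a sublinear functional\<close>

text \<open>
  Only the real structure of the space matters for the Hahn-Banach theorem, so a carrier inside a real
  vector space is the setting; it is instantiated below with scalars restricted to the reals.
\<close>

locale real_linear_subspace = vector_space scale
  for scale :: "real \<Rightarrow> 'v::ab_group_add \<Rightarrow> 'v" +
  fixes V :: "'v set"
  assumes subspace: "subspace V"
begin

lemmas V_closed [simp, intro] =
  subspace_0 [OF subspace] subspace_add [OF subspace] subspace_scale [OF subspace]
  subspace_neg [OF subspace] subspace_diff [OF subspace]

definition linear_functional :: "('v \<Rightarrow> real) \<Rightarrow> bool" where
  "linear_functional u \<longleftrightarrow>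
     (\<forall>x\<in>V. \<forall>y\<in>V. u (x + y) = u x + u y) \<and> (\<forall>r. \<forall>x\<in>V. u (scale r x) = r * u x)"

text \<open>
  An inequality suffices in the second clause: applied to \<open>r\<close> and to \<open>1/r\<close> it gives positive
  homogeneity.
\<close>

definition sublinear :: "('v \<Rightarrow> real) \<Rightarrow> bool" where
  "sublinear p \<longleftrightarrow>
     (\<forall>x\<in>V. \<forall>y\<in>V. p (x + y) \<le> p x + p y) \<and> (\<forall>r>0. \<forall>x\<in>V. p (scale r x) \<le> r * p x)"

lemma
  assumes "sublinear p"
  shows sublinear_add: "\<And>x y. x \<in> V \<Longrightarrow> y \<in> V \<Longrightarrow> p (x + y) \<le> p x + p y"
    and sublinear_scale_le: "\<And>r x. r > 0 \<Longrightarrow> x \<in> V \<Longrightarrow> p (scale r x) \<le> r * p x"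
  using assms by (auto simp: sublinear_def)

lemma sublinear_zero:
  assumes "sublinear p" shows "p 0 = 0"
  using sublinear_scale_le [OF assms, of 2 0] sublinear_scale_le [OF assms, of "1/2" 0] by simp

lemma sublinear_scale:
  assumes "sublinear p" "r \<ge> 0" "x \<in> V"
  shows "p (scale r x) = r * p x"
proof (cases "r = 0")
  case False
  then have r: "r > 0" using assms by simp
  have "p x \<le> inverse r * p (scale r x)"
    using sublinear_scale_le [OF assms(1), of "inverse r" "scale r x"] r assms(3) by simp
  then have "r * p x \<le> p (scale r x)"
    using r by (simp add: field_simps)
  with sublinear_scale_le [OF assms(1) r assms(3)] show ?thesis by simp
qed (simp add: sublinear_zero [OF assms(1)])

lemma sublinear_minus:
  assumes "sublinear p" "x \<in> V" shows "- p (- x) \<le> p x"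
  using sublinear_add [OF assms(1,2), of "- x"] assms(2) sublinear_zero [OF assms(1)] by simp

text \<open>
  The largest sublinear functional below \<open>p\<close> whose value at \<open>- a\<close> is at most \<open>- p a\<close>. It is used
  twice: to show that minimal sublinear functionals are additive, and to force a functional below \<open>p\<close>
  to attain the value \<open>p a\<close> at \<open>a\<close>. The value zero off \<open>V\<close> makes the functionals antisymmetrically
  ordered, as Zorn's lemma requires.
\<close>

definition tilt :: "('v \<Rightarrow> real) \<Rightarrow> 'v \<Rightarrow> 'v \<Rightarrow> real" where
  "tilt p a x = (if x \<in> V then INF t\<in>{0..}. p (x + scale t a) - t * p a else 0)"

lemma tilt_bounded_below:
  assumes "sublinear p" "a \<in> V" "x \<in> V" "t \<ge> 0"
  shows "- p (- x) \<le> p (x + scale t a) - t * p a"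
proof -
  have "t * p a = p ((x + scale t a) + (- x))"
    using sublinear_scale [OF assms(1,4,2)] by simp
  also have "\<dots> \<le> p (x + scale t a) + p (- x)"
    using assms by (intro sublinear_add) auto
  finally show ?thesis by simp
qed

lemma tilt_le:
  assumes "sublinear p" "a \<in> V" "x \<in> V" "t \<ge> 0"
  shows "tilt p a x \<le> p (x + scale t a) - t * p a"
proof -
  have "bdd_below ((\<lambda>t. p (x + scale t a) - t * p a) ` {0..})"
    by (rule bdd_belowI2 [where m = "- p (- x)"]) (use tilt_bounded_below [OF assms(1-3)] in auto)
  then show ?thesis using assms by (auto simp: tilt_def intro!: cINF_lower)
qed

lemma tilt_greatest:
  assumes "x \<in> V" "\<And>t. t \<ge> 0 \<Longrightarrow> m \<le> p (x + scale t a) - t * p a"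
  shows "m \<le> tilt p a x"
  using assms by (auto simp: tilt_def intro!: cINF_greatest)

lemma tilt_le_self:
  assumes "sublinear p" "a \<in> V" "x \<in> V" shows "tilt p a x \<le> p x"
  using tilt_le [OF assms, of 0] by simp

lemma sublinear_tilt:
  assumes "sublinear p" "a \<in> V"
  shows "sublinear (tilt p a)"
  unfolding sublinear_def
proof (intro conjI ballI allI impI)
  fix x y assume xy: "x \<in> V" "y \<in> V"
  have *: "tilt p a (x + y) \<le> (p (x + scale s a) - s * p a) + (p (y + scale t a) - t * p a)"
    if "s \<ge> 0" "t \<ge> 0" for s t
  proof -
    have "tilt p a (x + y) \<le> p ((x + y) + scale (s + t) a) - (s + t) * p a"
      using that xy assms by (intro tilt_le) auto
    also have "(x + y) + scale (s + t) a = (x + scale s a) + (y + scale t a)"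
      by (simp add: scale_left_distrib)
    also have "p \<dots> \<le> p (x + scale s a) + p (y + scale t a)"
      using xy assms by (intro sublinear_add) auto
    finally show ?thesis by (simp add: algebra_simps)
  qed
  have "tilt p a (x + y) - (p (x + scale s a) - s * p a) \<le> tilt p a y" if "s \<ge> 0" for s
    by (rule tilt_greatest) (use xy *[OF that] in \<open>auto simp: algebra_simps\<close>)
  then have "tilt p a (x + y) - tilt p a y \<le> tilt p a x"
    by (intro tilt_greatest) (use xy in \<open>auto simp: algebra_simps\<close>)
  then show "tilt p a (x + y) \<le> tilt p a x + tilt p a y" by simp
next
  fix r :: real and x assume r: "r > 0" and x: "x \<in> V"
  have "tilt p a (scale r x) / r \<le> tilt p a x"
  proof (rule tilt_greatest [OF x])
    fix t :: real assume t: "t \<ge> 0"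
    have "tilt p a (scale r x) \<le> p (scale r x + scale (r * t) a) - (r * t) * p a"
      using r t x assms by (intro tilt_le) auto
    also have "scale r x + scale (r * t) a = scale r (x + scale t a)"
      by (simp add: scale_right_distrib)
    also have "p \<dots> = r * p (x + scale t a)"
      using r x assms by (intro sublinear_scale) auto
    finally show "tilt p a (scale r x) / r \<le> p (x + scale t a) - t * p a"
      using r by (simp add: field_simps)
  qed
  then show "tilt p a (scale r x) \<le> r * tilt p a x"
    using r by (simp add: field_simps)
qed

lemma linear_functional_if_superadditive:
  assumes p: "sublinear p" and super: "\<And>x y. x \<in> V \<Longrightarrow> y \<in> V \<Longrightarrow> p x + p y \<le> p (x + y)"
  shows "linear_functional p"
proof -
  have add: "p (x + y) = p x + p y" if "x \<in> V" "y \<in> V" for x y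
    using sublinear_add [OF p that] super [OF that] by simp
  have neg: "p (- x) = - p x" if "x \<in> V" for x
    using add [OF that, of "- x"] that sublinear_zero [OF p] by simp
  have "p (scale r x) = r * p x" if "x \<in> V" for r x
  proof (cases "r \<ge> 0")
    case False
    then have "p (scale (- r) (- x)) = (- r) * p (- x)"
      using that by (intro sublinear_scale [OF p]) auto
    then show ?thesis using neg [OF that] by simp
  qed (use sublinear_scale [OF p _ that] in auto)
  with add show ?thesis by (auto simp: linear_functional_def)
qed

text \<open>
  Subadditivity survives in the infimum because of comparability: any sum \<open>p x + p' y\<close> with \<open>p, p'\<close> in
  the chain is at least \<open>p\<^sub>0 x + p\<^sub>0 y\<close> for the smaller functional \<open>p\<^sub>0\<close> of the two.
\<close>

lemma sublinear_INF_chain: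
  assumes C: "C \<noteq> {}" "\<And>p. p \<in> C \<Longrightarrow> sublinear p"
    and chain: "\<And>p p'. p \<in> C \<Longrightarrow> p' \<in> C \<Longrightarrow> p \<le> p' \<or> p' \<le> p"
    and low: "\<And>p x. p \<in> C \<Longrightarrow> x \<in> V \<Longrightarrow> m x \<le> p x"
  shows "sublinear (\<lambda>x. INF p\<in>C. p x)"
proof -
  have lower: "(INF p\<in>C. p x) \<le> p x" if "p \<in> C" "x \<in> V" for p x
    using that low by (intro cINF_lower bdd_belowI2 [where m = "m x"]) auto
  have greatest: "b \<le> (INF p\<in>C. p x)" if "\<And>p. p \<in> C \<Longrightarrow> b \<le> p x" for b x
    using that C(1) by (intro cINF_greatest) auto
  show ?thesis
    unfolding sublinear_def
  proof (intro conjI ballI allI impI)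
    fix x y assume xy: "x \<in> V" "y \<in> V"
    have *: "(INF p\<in>C. p (x + y)) \<le> p x + p' y" if "p \<in> C" "p' \<in> C" for p p'
      using chain [OF that]
    proof
      assume "p \<le> p'"
      then have "p x + p y \<le> p x + p' y" by (simp add: le_fun_def)
      with lower [OF that(1), of "x + y"] sublinear_add [OF C(2) [OF that(1)] xy] xy
      show ?thesis by auto
    next
      assume "p' \<le> p"
      then have "p' x + p' y \<le> p x + p' y" by (simp add: le_fun_def)
      with lower [OF that(2), of "x + y"] sublinear_add [OF C(2) [OF that(2)] xy] xy
      show ?thesis by auto
    qed
    have "(INF p\<in>C. p (x + y)) - p x \<le> (INF p\<in>C. p y)" if "p \<in> C" for p
      by (rule greatest) (use * [OF that] in \<open>auto simp: algebra_simps\<close>)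
    then have "(INF p\<in>C. p (x + y)) - (INF p\<in>C. p y) \<le> (INF p\<in>C. p x)"
      by (intro greatest) (auto simp: algebra_simps)
    then show "(INF p\<in>C. p (x + y)) \<le> (INF p\<in>C. p x) + (INF p\<in>C. p y)" by simp
  next
    fix r :: real and x assume r: "r > 0" and x: "x \<in> V"
    have "(INF p\<in>C. p (scale r x)) / r \<le> (INF p\<in>C. p x)"
    proof (rule greatest)
      fix p assume p: "p \<in> C"
      show "(INF p\<in>C. p (scale r x)) / r \<le> p x"
        using lower [OF p, of "scale r x"] sublinear_scale_le [OF C(2) [OF p] r x] r x
        by (auto simp: field_simps)
    qed
    then show "(INF p\<in>C. p (scale r x)) \<le> r * (INF p\<in>C. p x)"
      using r by (simp add: field_simps)
  qed
qed

text \<open>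
  Zorn's lemma yields a minimal sublinear functional \<open>p\<close> below \<open>q\<close>. By minimality tilting leaves \<open>p\<close>
  unchanged, so \<open>p x \<le> p (x + y) - p y\<close>; thus \<open>p\<close> is additive and hence linear.
\<close>

lemma linear_functional_below_sublinear:
  assumes q: "sublinear q"
  obtains u where "linear_functional u" "\<And>x. x \<in> V \<Longrightarrow> u x \<le> q x"
proof -
  define S where "S = {p. sublinear p \<and> (\<forall>x\<in>V. p x \<le> q x) \<and> (\<forall>x. x \<notin> V \<longrightarrow> p x = 0)}"
  have low: "- q (- x) \<le> p x" if "p \<in> S" "x \<in> V" for p x
  proof -
    have "p (- x) \<le> q (- x)" "- p (- x) \<le> p x"
      using that by (auto simp: S_def intro!: sublinear_minus)
    then show ?thesis by simp
  qed
  \<comment> \<open>The witness that the family is not empty, which serves as the bound of the empty chain.\<close>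
  define q0 where "q0 x = (if x \<in> V then q x else 0)" for x
  have q0: "q0 \<in> S"
    using q by (auto simp: S_def q0_def sublinear_def)
  have "\<exists>p\<in>S. \<forall>p'\<in>S. p' \<le> p \<longrightarrow> p' = p"
  proof (rule predicate_Zorn [where P = "\<lambda>p p'. p' \<le> p"])
    show "partial_order_on S (relation_of (\<lambda>p p'. p' \<le> p) S)"
      by (rule partial_order_on_relation_ofI) auto
  next
    fix C assume C: "C \<in> Chains (relation_of (\<lambda>p p'. p' \<le> p) S)"
    have CS: "C \<subseteq> S" and chain: "\<And>p p'. p \<in> C \<Longrightarrow> p' \<in> C \<Longrightarrow> p \<le> p' \<or> p' \<le> p"
      using C by (auto simp: Chains_def relation_of_def)
    show "\<exists>l\<in>S. \<forall>p\<in>C. l \<le> p"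
    proof (cases "C = {}")
      case True
      with q0 show ?thesis by auto
    next
      case False
      define l where "l = (\<lambda>x. INF p\<in>C. p x)"
      have "sublinear l"
        unfolding l_def using False CS chain low
        by (intro sublinear_INF_chain [where m = "\<lambda>x. - q (- x)"]) (auto simp: S_def)
      moreover have out: "p x = 0" if "x \<notin> V" "p \<in> C" for p x
        using that CS by (auto simp: S_def)
      have out': "l x = 0" if "x \<notin> V" for x
      proof -
        have "(\<lambda>p. p x) ` C = (\<lambda>p. 0) ` C" using out [OF that] by (intro image_cong) auto
        then show ?thesis using False by (simp add: l_def)
      qed
      moreover have le: "l x \<le> p x" if "p \<in> C" for p x
      proof (cases "x \<in> V")
        case True
        then show ?thesis unfolding l_def using that CS low
          by (intro cINF_lower bdd_belowI2 [where m = "- q (- x)"]) auto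
      qed (use out [OF _ that] out' in auto)
      moreover have "l x \<le> q x" if "x \<in> V" for x
      proof -
        obtain p where "p \<in> C" using False by blast
        then have "l x \<le> p x" "p x \<le> q x" using le CS that by (auto simp: S_def)
        then show ?thesis by simp
      qed
      ultimately have "l \<in> S" by (auto simp: S_def)
      with le show ?thesis by (auto simp: le_fun_def)
    qed
  qed
  then obtain p where p: "p \<in> S" and min: "\<And>p'. p' \<in> S \<Longrightarrow> p' \<le> p \<Longrightarrow> p' = p" by blast
  have sub: "sublinear p" using p by (simp add: S_def)
  have tilt_eq: "tilt p a = p" if "a \<in> V" for a
  proof (rule min)
    have le: "tilt p a x \<le> p x" if "x \<in> V" for x
      using tilt_le_self [OF sub \<open>a \<in> V\<close> that] .
    have "tilt p a x \<le> q x" if "x \<in> V" for x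
      using le [OF that] p that by (auto simp: S_def intro: order_trans)
    then show "tilt p a \<in> S"
      using sublinear_tilt [OF sub that] by (simp add: S_def tilt_def)
    show "tilt p a \<le> p"
    proof (rule le_funI)
      fix x show "tilt p a x \<le> p x"
        using le p by (cases "x \<in> V") (auto simp: S_def tilt_def)
    qed
  qed
  have "linear_functional p"
  proof (rule linear_functional_if_superadditive [OF sub])
    fix x y assume "x \<in> V" "y \<in> V"
    then show "p x + p y \<le> p (x + y)"
      using tilt_le [OF sub, of y x 1] tilt_eq [of y] by simp
  qed
  then show thesis using p by (intro that) (auto simp: S_def)
qed

text \<open>
  A linear functional below \<open>tilt q a\<close> is below \<open>q\<close> and satisfies \<open>u (- a) \<le> - q a\<close>, so it equals \<open>q\<close>
  at \<open>a\<close>.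
\<close>

lemma norming_functional:
  assumes q: "sublinear q" and sym: "\<And>x. x \<in> V \<Longrightarrow> q (- x) = q x" and a: "a \<in> V"
  obtains u where "linear_functional u" "\<And>x. x \<in> V \<Longrightarrow> \<bar>u x\<bar> \<le> q x" "u a = q a"
proof -
  obtain u where u: "linear_functional u" and le: "\<And>x. x \<in> V \<Longrightarrow> u x \<le> tilt q a x"
    using linear_functional_below_sublinear [OF sublinear_tilt [OF q a]] by blast
  have neg: "u (- x) = - u x" if "x \<in> V" for x
    using u that scale_minus_left [of 1 x] unfolding linear_functional_def
    by (metis mult_minus1 scale_one)
  have uq: "u x \<le> q x" if "x \<in> V" for x
    using le [OF that] tilt_le_self [OF q a that] by simp
  have abs: "\<bar>u x\<bar> \<le> q x" if "x \<in> V" for x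
    using uq [OF that] uq [of "- x"] neg [OF that] sym [OF that] that by auto
  have "u (- a) \<le> - q a"
    using le [of "- a"] tilt_le [OF q a, of "- a" 1] a sublinear_zero [OF q] by simp
  with neg [OF a] uq [OF a] have "u a = q a" by simp
  with u abs that show thesis by blast
qed

end

section \<open>Functionals unbounded on a set\<close>

text \<open>
  The signs are chosen one after the other: for real \<open>x\<close> and \<open>y\<close>, one of \<open>\<bar>x + y\<bar>\<close> and \<open>\<bar>x - y\<bar>\<close> is at
  least \<open>\<bar>y\<bar>\<close>, so the new term never cancels against the sum of the earlier ones.
\<close>

lemma signs_keeping_diagonal:
  fixes c :: "nat \<Rightarrow> nat \<Rightarrow> real"
  obtains s :: "nat \<Rightarrow> real"
    where "\<And>n. \<bar>s n\<bar> = 1" "\<And>n. \<bar>c n n\<bar> \<le> \<bar>\<Sum>k\<le>n. s k * c k n\<bar>"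
proof -
  have "\<exists>s. \<forall>n. \<bar>s n\<bar> = 1 \<and> \<bar>c n n\<bar> \<le> \<bar>(\<Sum>k<n. s k * c k n) + s n * c n n\<bar>"
  proof (rule dependent_wellorder_choice)
    fix r :: real and s s' :: "nat \<Rightarrow> real" and n
    assume "\<And>k. k < n \<Longrightarrow> s k = s' k"
    then have "(\<Sum>k<n. s k * c k n) = (\<Sum>k<n. s' k * c k n)" by (intro sum.cong) auto
    then show "(\<bar>r\<bar> = 1 \<and> \<bar>c n n\<bar> \<le> \<bar>(\<Sum>k<n. s k * c k n) + r * c n n\<bar>) =
               (\<bar>r\<bar> = 1 \<and> \<bar>c n n\<bar> \<le> \<bar>(\<Sum>k<n. s' k * c k n) + r * c n n\<bar>)" by simp
  next
    fix n and s :: "nat \<Rightarrow> real"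
    define x where "x = (\<Sum>k<n. s k * c k n)"
    have "\<bar>c n n\<bar> \<le> \<bar>x + 1 * c n n\<bar> \<or> \<bar>c n n\<bar> \<le> \<bar>x + (-1) * c n n\<bar>" by linarith
    moreover have "\<bar>1 :: real\<bar> = 1" "\<bar>-1 :: real\<bar> = 1" by auto
    ultimately show "\<exists>r. \<bar>r\<bar> = 1 \<and> \<bar>c n n\<bar> \<le> \<bar>(\<Sum>k<n. s k * c k n) + r * c n n\<bar>"
      unfolding x_def [symmetric] by blast
  qed
  then show thesis
    using that by (auto simp: lessThan_Suc_atMost [symmetric])
qed

context real_linear_subspace
begin

text \<open>
  A form of the uniform boundedness principle. In the signed series, the terms up to the \<open>n\<close>-th
  contribute at least \<open>3\<^sup>-\<^sup>n q a\<^sub>n\<close> at \<open>a\<^sub>n\<close>, while the later ones contribute at most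
  \<open>\<Sum>k>n. 3\<^sup>-\<^sup>k q a\<^sub>n\<close>, which is half of that. The ratio \<open>1/3\<close> is what makes the tail smaller than
  the leading part.
\<close>

lemma unbounded_functional:
  assumes q: "sublinear q" and sym: "\<And>x. x \<in> V \<Longrightarrow> q (- x) = q x"
    and A: "A \<subseteq> V" and unbounded: "\<And>M. \<exists>a\<in>A. M < q a"
  obtains u where "linear_functional u" "\<And>x. x \<in> V \<Longrightarrow> \<bar>u x\<bar> \<le> 2 * q x"
    "\<And>M. \<exists>a\<in>A. M < \<bar>u a\<bar>"
proof -
  obtain a where a: "\<And>n. a n \<in> A" and large: "\<And>n. 2 * real n * 3 ^ n < q (a n)"
  proof -
    have "\<forall>n. \<exists>b. b \<in> A \<and> 2 * real n * 3 ^ n < q b" using unbounded by blast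
    then show thesis using that by metis
  qed
  have aV: "a n \<in> V" for n using a A by auto
  have "\<exists>u. linear_functional u \<and> (\<forall>x\<in>V. \<bar>u x\<bar> \<le> q x) \<and> u (a n) = q (a n)" for n
    using norming_functional [OF q sym aV] by metis
  then obtain f where f: "\<And>n. linear_functional (f n)" and fq: "\<And>n x. x \<in> V \<Longrightarrow> \<bar>f n x\<bar> \<le> q x"
    and fa: "\<And>n. f n (a n) = q (a n)"
    by metis
  obtain s :: "nat \<Rightarrow> real" where s: "\<And>n. \<bar>s n\<bar> = 1"
    and diag: "\<And>n. \<bar>(1/3)^n * f n (a n)\<bar> \<le> \<bar>\<Sum>k\<le>n. s k * ((1/3)^k * f k (a n))\<bar>"
    using signs_keeping_diagonal [of "\<lambda>k n. (1/3)^k * f k (a n)"] by blast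
  define t where "t k x = s k * ((1/3)^k * f k x)" for k x
  have bound: "norm (t k x) \<le> (1/3)^k * q x" if "x \<in> V" for k x
    using fq [OF that] s by (simp add: t_def abs_mult)
  have geo: "(\<lambda>k. (1/3)^k * q x) sums (3/2 * q x)" for x
    using sums_mult2 [OF geometric_sums [of "1/3::real"], of "q x"] by simp
  have summ: "summable (\<lambda>k. t k x)" if "x \<in> V" for x
    by (rule summable_comparison_test' [OF sums_summable [OF geo [of x]] bound [OF that]])
  define u where "u x = (\<Sum>k. t k x)" for x
  show thesis
  proof (rule that)
    show "linear_functional u"
      unfolding linear_functional_def
    proof (intro conjI ballI allI)
      fix x y assume xy: "x \<in> V" "y \<in> V"
      have "t k (x + y) = t k x + t k y" for k
        using f xy by (simp add: t_def linear_functional_def algebra_simps)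
      then show "u (x + y) = u x + u y"
        unfolding u_def by (simp add: suminf_add summ xy)
    next
      fix r x assume x: "x \<in> V"
      have "t k (scale r x) = r * t k x" for k
        using f x by (simp add: t_def linear_functional_def)
      then show "u (scale r x) = r * u x"
        unfolding u_def by (simp add: suminf_mult summ x)
    qed
    show "\<bar>u x\<bar> \<le> 2 * q x" if "x \<in> V" for x
    proof -
      have "\<bar>u x\<bar> \<le> (\<Sum>k. (1/3)^k * q x)"
        using norm_suminf_le [OF bound [OF that] sums_summable [OF geo]] by (simp add: u_def)
      also have "\<dots> = 3/2 * q x" using geo sums_unique by metis
      finally show ?thesis using fq [OF that, of 0] by linarith
    qed
    show "\<exists>a\<in>A. M < \<bar>u a\<bar>" for M
    proof -
      obtain n where n: "M < real n" using reals_Archimedean2 by blast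
      have "u (a n) = (\<Sum>k. t (k + Suc n) (a n)) + (\<Sum>k<Suc n. t k (a n))"
        unfolding u_def by (rule suminf_split_initial_segment [OF summ [OF aV]])
      moreover have "\<bar>\<Sum>k. t (k + Suc n) (a n)\<bar> \<le> (1/3)^n * q (a n) / 2"
      proof -
        have *: "(\<lambda>k. (1/3)^(k + Suc n) * q (a n)) sums ((1/3)^n * q (a n) / 2)"
          using sums_mult2 [OF geo [of "a n"], of "(1/3)^Suc n"] by (simp add: power_add field_simps)
        have "norm (\<Sum>k. t (k + Suc n) (a n)) \<le> (\<Sum>k. (1/3)^(k + Suc n) * q (a n))"
          by (rule norm_suminf_le [OF bound [OF aV] sums_summable [OF *]])
        then show ?thesis using sums_unique [OF *] by simp
      qed
      moreover have "(1/3)^n * q (a n) \<le> \<bar>\<Sum>k<Suc n. t k (a n)\<bar>"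
        using order_trans [OF abs_ge_self diag [of n]] fa [of n] by (simp add: t_def lessThan_Suc_atMost)
      ultimately have "(1/3)^n * q (a n) / 2 \<le> \<bar>u (a n)\<bar>" by linarith
      moreover have "real n < (1/3)^n * q (a n) / 2"
        using large [of n] by (simp add: field_simps power_divide)
      ultimately show ?thesis using n a by (intro bexI [of _ "a n"]) auto
    qed
  qed
qed

end

section \<open>Scalars as pairs of reals\<close>

text \<open>
  Taking \<open>J = 0\<close> over the reals and \<open>J = \<i>\<close> over the complex numbers lets both cases share one
  formula for passing from real-linear functionals to linear ones. Over the reals the coordinate \<open>b\<close> is
  arbitrary.
\<close>

lemma scalar_coordinates:
  obtains J :: "'k::real_or_complex"
  where "J = 0 \<or> J * J = - 1"
    and "\<And>c. \<exists>a b. c = of_real a + J * of_real b"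
    and "\<And>a b. \<bar>a\<bar> \<le> norm (of_real a + J * of_real b)"
proof -
  obtain h :: "'k \<Rightarrow> complex" where add: "\<And>x y. h (x + y) = h x + h y"
    and mult: "\<And>x y. h (x * y) = h x * h y"
    and scaleR: "\<And>r x. h (r *\<^sub>R x) = r *\<^sub>R h x"
    and norm: "\<And>x. norm (h x) = norm x"
    and range: "range h = \<real> \<or> range h = UNIV"
    using real_or_complex [where 'a = 'k] by blast
  have inj: "x = y" if "h x = h y" for x y
  proof -
    have "h (x + (-1) *\<^sub>R y) = 0" using that by (simp only: add scaleR) simp
    then have "norm (x + (-1) *\<^sub>R y) = 0" using norm by (metis norm_zero)
    then show ?thesis by simp
  qed
  have one: "h 1 = 1"
    using mult [of 1 1] norm [of 1] by auto
  have of_real: "h (of_real r) = of_real r" for r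
    using scaleR [of r 1] one by (simp add: of_real_def)
  from range show thesis
  proof
    assume R: "range h = \<real>"
    have "\<exists>a b. c = of_real a + 0 * of_real b" for c :: 'k
    proof -
      have "h c \<in> \<real>" using R by auto
      then obtain r where "h c = of_real r" by (auto elim: Reals_cases)
      then have "c = of_real r" using inj of_real by metis
      then show ?thesis by auto
    qed
    then show thesis by (intro that [of 0]) auto
  next
    assume "range h = UNIV"
    then obtain J where J: "h J = \<i>" by (metis UNIV_I imageE)
    have coord: "h (of_real a + J * of_real b) = Complex a b" for a b
      by (simp add: add mult of_real J Complex_eq)
    show thesis
    proof (rule that)
      have "h (J * J) = h (of_real (-1))" by (simp only: mult J of_real) simp
      then show "J = 0 \<or> J * J = - 1" using inj by fastforce
      show "\<exists>a b. c = of_real a + J * of_real b" for c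
        using coord [of "Re (h c)" "Im (h c)"] inj by (metis complex.collapse)
      show "\<bar>a\<bar> \<le> norm (of_real a + J * of_real b)" for a b
        using coord [of a b] norm [of "of_real a + J * of_real b"] abs_Re_le_cmod [of "Complex a b"]
        by simp
    qed
  qed
qed

section \<open>Weakly bounded sets are bounded\<close>

context locally_convex_space
begin

lemmas topspace_closed [simp, intro] =
  subspace_0 [OF subspace_topspace] subspace_add [OF subspace_topspace]
  subspace_scale [OF subspace_topspace] subspace_neg [OF subspace_topspace]
  subspace_diff [OF subspace_topspace]

lemma real_linear_subspace_topspace:
  "real_linear_subspace (\<lambda>r. smul (of_real r)) (topspace T)"
proof -
  interpret R: vector_space "\<lambda>r. smul (of_real r)"
    by standard (simp_all add: scale_right_distrib scale_left_distrib)
  show ?thesis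
    by standard (auto simp: R.subspace_def)
qed

lemma continuous_map_translate:
  assumes "z \<in> topspace T" shows "continuous_map T T (\<lambda>x. x + z)"
proof -
  have "continuous_map T (prod_topology T T) (\<lambda>x. (x, z))"
    using assms by (intro continuous_map_pairedI) auto
  from continuous_map_compose [OF this continuous_add] show ?thesis by (simp add: o_def)
qed

lemma continuous_map_smul: "continuous_map T T (\<lambda>x. smul c x)"
proof -
  have "continuous_map T (prod_topology euclidean T) (\<lambda>x. (c, x))"
    by (intro continuous_map_pairedI) auto
  from continuous_map_compose [OF this continuous_scale] show ?thesis by (simp add: o_def)
qed

lemma continuous_map_smul_left:
  assumes "x \<in> topspace T" shows "continuous_map euclidean T (\<lambda>c. smul c x)"
proof -
  have "continuous_map euclidean (prod_topology euclidean T) (\<lambda>c. (c, x))"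
    using assms by (intro continuous_map_pairedI) auto
  from continuous_map_compose [OF this continuous_scale] show ?thesis by (simp add: o_def)
qed

text \<open>
  Homogeneity is over all scalars, not only the real ones: boundedness of a set is tested with dilations
  by arbitrary scalars.
\<close>

definition seminorm :: "('v \<Rightarrow> real) \<Rightarrow> bool" where
  "seminorm q \<longleftrightarrow>
     (\<forall>x\<in>topspace T. \<forall>y\<in>topspace T. q (x + y) \<le> q x + q y) \<and>
     (\<forall>c. \<forall>x\<in>topspace T. q (smul c x) = norm c * q x)"

text \<open>
  The seminorm is the Minkowski functional of the balanced core \<open>W\<close> of a convex neighbourhood \<open>V\<close>. The
  core is convex and balanced; joint continuity of scalar multiplication at the origin shows that it
  still contains a neighbourhood \<open>N\<close> of zero.
\<close>

lemma gauge_seminorm: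
  assumes U: "openin T U" "0 \<in> U"
  obtains q N where "seminorm q" "openin T N" "0 \<in> N" "\<And>x. x \<in> N \<Longrightarrow> q x \<le> 1"
    "\<And>x. x \<in> topspace T \<Longrightarrow> q x < 1 \<Longrightarrow> x \<in> U"
proof -
  obtain V where V: "openin T V" "0 \<in> V" "V \<subseteq> U"
    and convex: "\<And>x y u v. x \<in> V \<Longrightarrow> y \<in> V \<Longrightarrow> u \<ge> 0 \<Longrightarrow> v \<ge> 0 \<Longrightarrow> u + v = 1 \<Longrightarrow>
              smul (of_real u) x + smul (of_real v) y \<in> V"
  proof -
    from locally_convex [OF U] obtain V where "openin T V" "0 \<in> V" "V \<subseteq> U"
      "\<forall>x\<in>V. \<forall>y\<in>V. \<forall>u\<ge>0. \<forall>v\<ge>0. u + v = 1 \<longrightarrow>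
         smul (of_real u) x + smul (of_real v) y \<in> V"
      by (elim exE conjE)
    then show thesis by (intro that [of V]) auto
  qed
  define W where "W = {x \<in> topspace T. \<forall>c. norm c \<le> 1 \<longrightarrow> smul c x \<in> V}"
  have WU: "W \<subseteq> U"
  proof
    fix x assume "x \<in> W"
    then have "norm (1 :: 'k) \<le> 1 \<longrightarrow> smul 1 x \<in> V" unfolding W_def by blast
    then show "x \<in> U" using V(3) by auto
  qed
  have W_top: "x \<in> topspace T" if "x \<in> W" for x using that by (simp add: W_def)
  have W_convex: "smul (of_real u) x + smul (of_real v) y \<in> W"
    if "x \<in> W" "y \<in> W" "u \<ge> 0" "v \<ge> 0" "u + v = 1" for x y u v
  proof -
    have "smul c (smul (of_real u) x + smul (of_real v) y) \<in> V" if c: "norm c \<le> 1" for c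
    proof -
      have "smul (of_real u) (smul c x) + smul (of_real v) (smul c y) \<in> V"
        using \<open>x \<in> W\<close> \<open>y \<in> W\<close> \<open>u \<ge> 0\<close> \<open>v \<ge> 0\<close> \<open>u + v = 1\<close> c by (intro convex) (auto simp: W_def)
      then show ?thesis by (simp add: scale_right_distrib mult.commute)
    qed
    with that show ?thesis by (auto simp: W_def)
  qed
  have W_balanced: "smul c x \<in> W" if "x \<in> W" "norm c \<le> 1" for c x
  proof -
    have "norm (d * c) \<le> 1" if "norm d \<le> 1" for d
      using that \<open>norm c \<le> 1\<close> by (simp add: norm_mult mult_le_one)
    with \<open>x \<in> W\<close> show ?thesis by (auto simp: W_def)
  qed
  obtain N where N: "openin T N" "0 \<in> N" "N \<subseteq> W"
  proof -
    define P where "P = {z \<in> topspace (prod_topology euclidean T). (case z of (c, x) \<Rightarrow> smul c x) \<in> V}"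
    have "openin (prod_topology euclidean T) P"
      unfolding P_def using continuous_scale V(1) by (rule openin_continuous_map_preimage)
    moreover have "(0, 0) \<in> P" using V(2) by (auto simp: P_def)
    ultimately obtain D B where D: "open D" "0 \<in> D" and B: "openin T B" "0 \<in> B" and DB: "D \<times> B \<subseteq> P"
      unfolding openin_prod_topology_alt by (metis open_openin)
    obtain d where d: "d > 0" "cball 0 d \<subseteq> D"
      using D open_contains_cball by blast
    define N where "N = {x \<in> topspace T. smul (of_real (inverse d)) x \<in> B}"
    show thesis
    proof
      show "openin T N"
        unfolding N_def using continuous_map_smul B(1) by (rule openin_continuous_map_preimage)
      show "0 \<in> N" using B(2) by (auto simp: N_def)
      show "N \<subseteq> W"
      proof
        fix x assume x: "x \<in> N"
        have "smul c x \<in> V" if "norm c \<le> 1" for c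
        proof -
          have "c * of_real d \<in> cball 0 d"
            using that d(1) by (simp add: norm_mult mult_le_cancel_right1)
          then have "(c * of_real d, smul (of_real (inverse d)) x) \<in> P"
            using d(2) DB x by (auto simp: N_def)
          then have "smul (c * of_real d * of_real (inverse d)) x \<in> V" by (simp add: P_def)
          also have "c * of_real d * of_real (inverse d) = c" using d(1) by simp
          finally show ?thesis .
        qed
        with x show "x \<in> W" by (auto simp: W_def N_def)
      qed
    qed
  qed
  define S where "S x = {t. t > 0 \<and> smul (of_real (inverse t)) x \<in> W}" for x
  define q where "q x = Inf (S x)" for x
  have S_nonempty: "S x \<noteq> {}" if "x \<in> topspace T" for x
  proof -
    have "openin euclidean {c \<in> topspace euclidean. smul c x \<in> N}"
      using continuous_map_smul_left [OF that] N(1) by (rule openin_continuous_map_preimage)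
    then have "open {c. smul c x \<in> N}" by simp
    moreover have "0 \<in> {c. smul c x \<in> N}" using N(2) by simp
    ultimately obtain d where d: "d > 0" "cball 0 d \<subseteq> {c. smul c x \<in> N}"
      using open_contains_cball by blast
    then have "of_real d \<in> {c. smul c x \<in> N}" by (intro subsetD [OF d(2)]) auto
    then have "inverse d \<in> S x" using d(1) N(3) by (auto simp: S_def)
    then show ?thesis by blast
  qed
  have q_le: "q x \<le> t" if "t \<in> S x" for x t
    unfolding q_def by (rule cInf_lower [OF that bdd_belowI [of _ 0]]) (auto simp: S_def)
  have q_ge: "m \<le> q x" if "x \<in> topspace T" "\<And>t. t \<in> S x \<Longrightarrow> m \<le> t" for x m
    unfolding q_def by (rule cInf_greatest [OF S_nonempty]) (use that in auto)
  have q_nonneg: "0 \<le> q x" if "x \<in> topspace T" for x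
    by (rule q_ge [OF that]) (auto simp: S_def)
  have q_zero: "q 0 = 0"
  proof -
    have "q 0 \<le> 0 + e" if "e > 0" for e
      using that N(2,3) by (intro order_trans [OF q_le]) (auto simp: S_def)
    then have "q 0 \<le> 0" by (rule field_le_epsilon)
    with q_nonneg [of 0] show ?thesis by simp
  qed
  have q_scale_le: "q (smul c x) \<le> norm c * q x" if x: "x \<in> topspace T" and c: "c \<noteq> 0" for c x
  proof -
    have "q (smul c x) / norm c \<le> q x"
    proof (rule q_ge [OF x])
      fix t assume t: "t \<in> S x"
      have "smul (c * of_real (inverse (norm c))) (smul (of_real (inverse t)) x) \<in> W"
        by (rule W_balanced) (use t c in \<open>auto simp: S_def norm_mult norm_inverse\<close>)
      then have "norm c * t \<in> S (smul c x)"
        using t c by (auto simp: S_def mult.commute mult.left_commute)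
      then show "q (smul c x) / norm c \<le> t"
        using q_le c by (simp add: field_simps)
    qed
    then show ?thesis using c by (simp add: field_simps)
  qed
  have q_scale: "q (smul c x) = norm c * q x" if x: "x \<in> topspace T" for c x
  proof (cases "c = 0")
    case False
    have "q x \<le> inverse (norm c) * q (smul c x)"
      using q_scale_le [of "smul c x" "inverse c"] x False by (simp add: norm_inverse)
    then have "norm c * q x \<le> q (smul c x)" using False by (simp add: field_simps)
    with q_scale_le [OF x False] show ?thesis by simp
  qed (simp add: q_zero)
  have q_add: "q (x + y) \<le> q x + q y" if x: "x \<in> topspace T" and y: "y \<in> topspace T" for x y
  proof -
    have *: "q (x + y) \<le> s + t" if s: "s \<in> S x" and t: "t \<in> S y" for s t
    proof (rule q_le)
      have st: "s > 0" "t > 0" using s t by (auto simp: S_def)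
      have "smul (of_real (s / (s + t))) (smul (of_real (inverse s)) x)
          + smul (of_real (t / (s + t))) (smul (of_real (inverse t)) y) \<in> W"
        using s t st by (intro W_convex) (auto simp: S_def add_divide_distrib [symmetric])
      moreover have "(of_real (s / (s + t)) * of_real (inverse s) :: 'k) = of_real (inverse (s + t))"
        "(of_real (t / (s + t)) * of_real (inverse t) :: 'k) = of_real (inverse (s + t))"
        unfolding of_real_mult [symmetric] using st by (simp_all add: field_simps)
      ultimately have "smul (of_real (inverse (s + t))) (x + y) \<in> W"
        by (simp only: scale_scale scale_right_distrib)
      then show "s + t \<in> S (x + y)" using st by (simp add: S_def)
    qed
    have "q (x + y) - s \<le> q y" if "s \<in> S x" for s
      by (rule q_ge [OF y]) (use * [OF that] in \<open>auto simp: algebra_simps\<close>)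
    then have "q (x + y) - q y \<le> q x"
      by (intro q_ge [OF x]) (auto simp: algebra_simps)
    then show ?thesis by simp
  qed
  show thesis
  proof (rule that)
    show "seminorm q" using q_add q_scale by (simp add: seminorm_def)
    show "openin T N" "0 \<in> N" using N by auto
    show "q x \<le> 1" if "x \<in> N" for x
      using that N(3) by (intro q_le) (auto simp: S_def)
    show "x \<in> U" if x: "x \<in> topspace T" and "q x < 1" for x
    proof -
      obtain t where t: "t \<in> S x" "t < 1"
        using q_ge [OF x, of 1] \<open>q x < 1\<close> by force
      then have "smul (of_real t) (smul (of_real (inverse t)) x) \<in> W"
        by - (rule W_balanced, auto simp: S_def)
      moreover have "(of_real t * of_real (inverse t) :: 'k) = 1" using t by (simp add: S_def)
      ultimately show ?thesis using WU by auto
    qed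
  qed
qed

text \<open>
  By additivity, continuity at \<open>x\<close> is continuity at zero, moved to \<open>x\<close> by a translation; at zero it
  follows from the bound \<open>C * q\<close>, since \<open>q\<close> is small on small multiples of \<open>N\<close>.
\<close>

lemma dual_space_if_dominated:
  assumes q: "seminorm q" and N: "openin T N" "0 \<in> N" "\<And>x. x \<in> N \<Longrightarrow> q x \<le> 1"
    and add: "\<And>x y. x \<in> topspace T \<Longrightarrow> y \<in> topspace T \<Longrightarrow> f (x + y) = f x + f y"
    and scale: "\<And>c x. x \<in> topspace T \<Longrightarrow> f (smul c x) = c * f x"
    and out: "\<And>x. x \<notin> topspace T \<Longrightarrow> f x = 0"
    and le: "\<And>x. x \<in> topspace T \<Longrightarrow> norm (f x) \<le> C * q x" and C: "C > 0"
  shows "f \<in> dual_space smul T"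
proof -
  have "topcontinuous_at T euclidean f x" if x: "x \<in> topspace T" for x
    unfolding topcontinuous_at_def
  proof (intro conjI allI impI)
    fix V assume "openin euclidean V \<and> f x \<in> V"
    then obtain e where e: "e > 0" "ball (f x) e \<subseteq> V"
      by (metis open_contains_ball open_openin)
    define s where "s = 2 * C / e"
    have s: "s > 0" using e C by (simp add: s_def)
    define W where "W = {y \<in> topspace T. smul (of_real s) (y + (- x)) \<in> N}"
    have "continuous_map T T (\<lambda>y. smul (of_real s) (y + (- x)))"
      using continuous_map_compose [OF continuous_map_translate [of "- x"] continuous_map_smul] x
      by (simp add: o_def)
    then have W: "openin T W"
      unfolding W_def using N(1) by (rule openin_continuous_map_preimage)
    have "f y \<in> V" if y: "y \<in> W" for y
    proof -
      have z: "y - x \<in> topspace T" using x y by (auto simp: W_def)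
      have "s * q (y - x) = q (smul (of_real s) (y - x))"
        using q z s by (simp add: seminorm_def)
      also have "\<dots> \<le> 1" using y by (intro N(3)) (simp add: W_def)
      finally have "C * q (y - x) \<le> e / 2"
        using e C by (simp add: s_def field_simps)
      moreover have "f y = f (y - x) + f x" using add [OF z x] by simp
      ultimately have "norm (f y - f x) < e" using le [OF z] e(1) by simp
      then show ?thesis using e(2) by (auto simp: dist_norm norm_minus_commute)
    qed
    then show "\<exists>W. openin T W \<and> x \<in> W \<and> (\<forall>y\<in>W. f y \<in> V)"
      using W x N(2) by (intro exI [of _ W]) (auto simp: W_def)
  qed (use x in auto)
  then have "continuous_map T euclidean f" by (simp add: continuous_map_eq_topcontinuous_at)
  with add scale out show ?thesis by (simp add: dual_space_def)
qed

text \<open>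
  Bohnenblust and Sobczyk's device: \<open>f x = u x - \<i> u (\<i> x)\<close> is complex linear with real part \<open>u\<close>. The
  factor 2 matches the bound of \<open>unbounded_functional\<close>.
\<close>

lemma dual_functional_dominating:
  assumes q: "seminorm q" and N: "openin T N" "0 \<in> N" "\<And>x. x \<in> N \<Longrightarrow> q x \<le> 1"
    and u: "real_linear_subspace.linear_functional (\<lambda>r. smul (of_real r)) (topspace T) u"
    and uq: "\<And>x. x \<in> topspace T \<Longrightarrow> \<bar>u x\<bar> \<le> 2 * q x"
  obtains f where "f \<in> dual_space smul T" "\<And>x. x \<in> topspace T \<Longrightarrow> \<bar>u x\<bar> \<le> norm (f x)"
proof -
  interpret R: real_linear_subspace "\<lambda>r. smul (of_real r)" "topspace T"
    by (rule real_linear_subspace_topspace)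
  have u_add: "u (x + y) = u x + u y" if "x \<in> topspace T" "y \<in> topspace T" for x y
    using u that by (simp add: R.linear_functional_def)
  have u_scale: "u (smul (of_real r) x) = r * u x" if "x \<in> topspace T" for r x
    using u that by (simp add: R.linear_functional_def)
  obtain J :: 'k where J: "J = 0 \<or> J * J = - 1"
    and coord: "\<And>c. \<exists>a b. c = of_real a + J * of_real b"
    and abs_le: "\<And>a b. \<bar>a\<bar> \<le> norm (of_real a + J * of_real b)"
    using scalar_coordinates by blast
  define f where "f x = (if x \<in> topspace T then of_real (u x) - J * of_real (u (smul J x)) else 0)" for x
  show thesis
  proof (rule that)
    show "f \<in> dual_space smul T"
    proof (rule dual_space_if_dominated [OF q N])
      show "f (x + y) = f x + f y" if "x \<in> topspace T" "y \<in> topspace T" for x y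
        using that by (simp add: f_def u_add scale_right_distrib algebra_simps)
      show "f (smul c x) = c * f x" if x: "x \<in> topspace T" for c x
      proof -
        obtain a b where c: "c = of_real a + J * of_real b" using coord by blast
        have "smul c x = smul (of_real a) x + smul (of_real b) (smul J x)"
          by (simp add: c scale_left_distrib mult.commute)
        then have 1: "u (smul c x) = a * u x + b * u (smul J x)"
          using x by (simp only: u_add u_scale topspace_closed)
        have "smul J (smul c x) = smul (of_real a) (smul J x) + smul (of_real b) (smul (J * J) x)"
          by (simp add: c algebra_simps)
        then have 2: "u (smul J (smul c x)) = a * u (smul J x) + b * u (smul (J * J) x)"
          using x by (simp only: u_add u_scale topspace_closed)
        from J show ?thesis
        proof
          assume "J = 0"
          then show ?thesis using 1 u_scale [OF x, of 0] x by (simp add: f_def c)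
        next
          assume JJ: "J * J = - 1"
          have 3: "u (smul (J * J) x) = - u x"
            using u_scale [OF x, of "-1"] by (simp add: JJ)
          have "c * f x = of_real a * of_real (u x) + J * of_real b * of_real (u x)
              - J * of_real a * of_real (u (smul J x)) - (J * J) * of_real b * of_real (u (smul J x))"
            using x by (simp add: f_def c algebra_simps)
          then show ?thesis
            using x unfolding JJ by (simp add: f_def 1 2 3 distrib_left right_diff_distrib mult.assoc
              del: scale_scale)
        qed
      qed
      show "norm (f x) \<le> (2 + 2 * norm J * norm J) * q x" if x: "x \<in> topspace T" for x
      proof -
        have "norm (f x) \<le> \<bar>u x\<bar> + norm J * \<bar>u (smul J x)\<bar>"
          using x norm_triangle_ineq4 [of "of_real (u x)" "J * of_real (u (smul J x))"]
          by (simp add: f_def norm_mult)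
        also have "\<dots> \<le> 2 * q x + norm J * (2 * q (smul J x))"
          using x by (intro add_mono mult_left_mono uq) auto
        also have "q (smul J x) = norm J * q x" using q x by (simp add: seminorm_def)
        finally show ?thesis by (simp add: algebra_simps)
      qed
      show "2 + 2 * norm J * norm J > 0" by (smt (verit) mult_nonneg_nonneg norm_ge_zero)
    qed (auto simp: f_def)
    show "\<bar>u x\<bar> \<le> norm (f x)" if "x \<in> topspace T" for x
      using abs_le [of "u x" "- u (smul J x)"] that by (simp add: f_def)
  qed
qed

text \<open>
  Mackey's theorem. Each neighbourhood \<open>U\<close> contains the open unit ball of a continuous seminorm, and \<open>A\<close>
  is absorbed by \<open>U\<close> once this seminorm is bounded on \<open>A\<close>.
\<close>

theorem bounded_in_if_weakly_bounded:
  assumes A: "A \<subseteq> topspace T"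
    and weak: "\<And>f. f \<in> dual_space smul T \<Longrightarrow> \<exists>M. \<forall>a\<in>A. norm (f a) \<le> M"
  shows "bounded_in smul T A"
  unfolding bounded_in_def
proof (intro conjI allI impI)
  interpret R: real_linear_subspace "\<lambda>r. smul (of_real r)" "topspace T"
    by (rule real_linear_subspace_topspace)
  fix U assume "openin T U \<and> 0 \<in> U"
  then obtain q N where q: "seminorm q" and N: "openin T N" "0 \<in> N" "\<And>x. x \<in> N \<Longrightarrow> q x \<le> 1"
    and qU: "\<And>x. x \<in> topspace T \<Longrightarrow> q x < 1 \<Longrightarrow> x \<in> U"
    using gauge_seminorm by blast
  have q_scale: "q (smul c x) = norm c * q x" if "x \<in> topspace T" for c x
    using q that by (simp add: seminorm_def)
  have "\<exists>M. \<forall>a\<in>A. q a \<le> M"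
  proof (rule ccontr)
    assume "\<not> ?thesis"
    then have unbounded: "\<exists>a\<in>A. M < q a" for M by (meson not_le)
    have "R.sublinear q"
      using q by (auto simp: R.sublinear_def seminorm_def)
    moreover have "q (- x) = q x" if "x \<in> topspace T" for x
      using q_scale [OF that, of "-1"] by simp
    ultimately obtain u where u: "R.linear_functional u"
      and uq: "\<And>x. x \<in> topspace T \<Longrightarrow> \<bar>u x\<bar> \<le> 2 * q x"
      and u_unbounded: "\<And>M. \<exists>a\<in>A. M < \<bar>u a\<bar>"
      using R.unbounded_functional [OF _ _ A unbounded] by blast
    obtain f where f: "f \<in> dual_space smul T" and uf: "\<And>x. x \<in> topspace T \<Longrightarrow> \<bar>u x\<bar> \<le> norm (f x)"
      using dual_functional_dominating [OF q N u uq] by blast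
    obtain M where M: "\<And>a. a \<in> A \<Longrightarrow> norm (f a) \<le> M" using weak [OF f] by blast
    obtain a where "a \<in> A" "M < \<bar>u a\<bar>" using u_unbounded by blast
    with M [of a] uf [of a] A show False by auto
  qed
  then obtain M where M: "\<And>a. a \<in> A \<Longrightarrow> q a \<le> M" by blast
  have "A \<subseteq> smul c ` U" if c: "max M 0 < norm c" for c
  proof
    fix a assume a: "a \<in> A"
    have c0: "c \<noteq> 0" using c by auto
    have "q (smul (inverse c) a) = q a / norm c"
      using q_scale [of a "inverse c"] a A by (auto simp: norm_inverse divide_inverse mult.commute)
    also have "\<dots> < 1" using M [OF a] c by (simp add: field_simps)
    finally have "smul (inverse c) a \<in> U" using a A by (intro qU) auto
    moreover have "a = smul c (smul (inverse c) a)" using c0 by simp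
    ultimately show "a \<in> smul c ` U" by blast
  qed
  then show "\<exists>r. \<forall>c. r < norm c \<longrightarrow> A \<subseteq> smul c ` U" by blast
qed (rule A)

end

section \<open>Convergence in the strong dual\<close>

lemma dual_smul_in_dual_space:
  assumes "f \<in> dual_space smul T" shows "dual_smul c f \<in> dual_space smul T"
proof -
  have "continuous_map euclidean euclidean (\<lambda>x. c * x)"
    by (auto intro!: continuous_intros)
  with assms have "continuous_map T euclidean (\<lambda>x. c * f x)"
    using continuous_map_compose [of T euclidean f euclidean "\<lambda>x. c * x"]
    by (auto simp: dual_space_def o_def)
  with assms show ?thesis
    by (auto simp: dual_space_def dual_smul_def algebra_simps)
qed

lemma zero_in_dual_space: "0 \<in> dual_space smul T"
  by (simp add: dual_space_def zero_fun_def)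

lemma in_ell_geometric:
  assumes "1 \<le> p"
  shows "in_ell p (\<lambda>n. of_real ((1/2)^n) * z)"
proof (cases "p = \<infinity>")
  case True
  have "(\<lambda>n. of_real ((1/2)^n) * z) \<longlonglongrightarrow> of_real 0 * z"
    by (intro tendsto_intros LIMSEQ_power_zero) auto
  then show ?thesis using True by (simp add: in_ell_def)
next
  case False
  define r where "r = enn2real p"
  have "r \<ge> 1"
    using enn2real_mono [OF assms] False by (simp add: r_def less_top)
  \<comment> \<open>For exponents at least 1, raising the numbers \<open>(1/2)^n\<close> to the power \<open>r\<close> only makes them smaller.\<close>
  have "summable (\<lambda>n. (1/2)^n * norm z powr r)"
    by (intro summable_mult2 summable_geometric) auto
  then have "summable (\<lambda>n. norm (of_real ((1/2)^n) * z) powr r)"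
  proof (rule summable_comparison_test')
    fix n
    have "((1/2)^n :: real) powr r \<le> (1/2)^n"
      using \<open>r \<ge> 1\<close> by (intro powr_le_one_le) (auto intro: power_le_one)
    then show "norm (norm (of_real ((1/2)^n) * z) powr r) \<le> (1/2)^n * norm z powr r"
      by (simp add: norm_mult powr_mult mult_right_mono norm_power norm_divide)
  qed
  then show ?thesis using False by (simp add: in_ell_def r_def)
qed

text \<open>
  The test sequence is \<open>2\<^sup>-\<^sup>n f\<close>. As soon as one of its suprema over \<open>A\<close> is below 1, \<open>f\<close> is bounded by
  \<open>2\<^sup>n\<close> on \<open>A\<close>.
\<close>

lemma p_V_star_set_weakly_bounded:
  assumes A: "p_V_star_set p smul T A" and p: "1 \<le> p" and f: "f \<in> dual_space smul T"
  shows "\<exists>M. \<forall>a\<in>A. norm (f a) \<le> M"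
proof -
  define \<phi> where "\<phi> n = dual_smul (of_real ((1/2)^n)) f" for n :: nat
  have "weakly_p_summable p dual_smul (strong_dual smul T) \<phi>"
    unfolding weakly_p_summable_def topspace_strong_dual
  proof (intro conjI allI ballI)
    show "\<phi> n \<in> dual_space smul T" for n
      unfolding \<phi>_def by (rule dual_smul_in_dual_space [OF f])
    fix F assume "F \<in> dual_space dual_smul (strong_dual smul T)"
    then have "F (\<phi> n) = of_real ((1/2)^n) * F f" for n
      using f unfolding dual_space_def [of dual_smul] topspace_strong_dual \<phi>_def by blast
    then show "in_ell p (\<lambda>n. F (\<phi> n))" using in_ell_geometric [OF p] by simp
  qed
  then have "(\<lambda>n. SUP a\<in>A. ennreal (norm (\<phi> n a))) \<longlonglongrightarrow> 0"
    using A by (simp add: p_V_star_set_def)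
  then have "eventually (\<lambda>n. (SUP a\<in>A. ennreal (norm (\<phi> n a))) < 1) sequentially"
    by (rule order_tendstoD) simp
  then obtain n where n: "(SUP a\<in>A. ennreal (norm (\<phi> n a))) < 1"
    by (auto simp: eventually_sequentially)
  have "norm (f a) \<le> 2^n" if "a \<in> A" for a
  proof -
    have "ennreal (norm (\<phi> n a)) < 1" using n that by (meson SUP_upper le_less_trans)
    then have "norm (\<phi> n a) < 1" by simp
    then show ?thesis by (simp add: \<phi>_def dual_smul_def norm_mult norm_power norm_divide field_simps)
  qed
  then show ?thesis by blast
qed

text \<open>
  The empty set is bounded too, but the neighbourhood that it defines is the whole dual, so only
  non-empty sets need to be considered.
\<close>

lemma limitin_strong_dual_zero_iff:
  assumes \<phi>: "\<And>n. \<phi> n \<in> dual_space smul T"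
  shows "limitin (strong_dual smul T) \<phi> 0 sequentially \<longleftrightarrow>
    (\<forall>A. A \<noteq> {} \<and> bounded_in smul T A \<longrightarrow> (\<lambda>n. SUP a\<in>A. ennreal (norm (\<phi> n a))) \<longlonglongrightarrow> 0)"
    (is "?L \<longleftrightarrow> ?R")
proof
  assume L: ?L
  show ?R
  proof (intro allI impI, elim conjE)
    fix A assume A: "A \<noteq> {}" "bounded_in smul T A"
    show "(\<lambda>n. SUP a\<in>A. ennreal (norm (\<phi> n a))) \<longlonglongrightarrow> 0"
    proof (rule order_tendstoI)
      fix e :: ennreal assume "0 < e"
      then obtain x where x: "0 < x" "x < e" using dense by blast
      then have fin: "x < top" using order_less_le_trans top_greatest by blast
      define d where "d = enn2real x"
      have d: "0 < d" "ennreal d < e" using x fin by (auto simp: d_def enn2real_positive_iff)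
      \<comment> \<open>A bound \<open>c\<close> strictly below \<open>d\<close> leaves room for a perturbation; the set of all \<open>g\<close> with
        \<open>norm (g a) \<le> d\<close> on \<open>A\<close> need not be open.\<close>
      define W where "W = {g \<in> dual_space smul T. \<exists>c<d. \<forall>a\<in>A. norm (g a) \<le> c}"
      have "strong_open smul T W"
        unfolding strong_open_def
      proof (intro conjI ballI)
        show "W \<subseteq> dual_space smul T" by (auto simp: W_def)
        fix f assume "f \<in> W"
        then obtain c where c: "c < d" "\<And>a. a \<in> A \<Longrightarrow> norm (f a) \<le> c" by (auto simp: W_def)
        have "g \<in> W" if "g \<in> dual_space smul T" "\<forall>x\<in>A. norm (g x - f x) \<le> (d - c) / 2" for g
        proof -
          have "norm (g a) \<le> (d + c) / 2" if "a \<in> A" for a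
          proof -
            have "norm (g a - f a) \<le> (d - c) / 2" using \<open>\<forall>x\<in>A. _\<close> that by blast
            with c(2) [OF that] norm_triangle_sub [of "g a" "f a"] show ?thesis
              by (simp add: field_simps)
          qed
          moreover have "(d + c) / 2 < d" using c(1) by simp
          ultimately show ?thesis using that(1) unfolding W_def by blast
        qed
        then show "\<exists>A e. bounded_in smul T A \<and> e > 0 \<and>
            {g \<in> dual_space smul T. \<forall>x\<in>A. norm (g x - f x) \<le> e} \<subseteq> W"
          using A(2) c(1) by (intro exI [of _ A] exI [of _ "(d - c) / 2"]) auto
      qed
      moreover have "0 \<in> W"
        using zero_in_dual_space d(1) by (auto simp: W_def intro!: exI [of _ 0])
      ultimately have "eventually (\<lambda>n. \<phi> n \<in> W) sequentially"
        using L by (simp add: limitin_def openin_strong_dual)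
      then show "eventually (\<lambda>n. (SUP a\<in>A. ennreal (norm (\<phi> n a))) < e) sequentially"
      proof eventually_elim
        case (elim n)
        then have "(SUP a\<in>A. ennreal (norm (\<phi> n a))) \<le> ennreal d"
          by (intro SUP_least ennreal_leI) (force simp: W_def)
        with d(2) show ?case by simp
      qed
    qed simp
  qed
next
  assume R: ?R
  show ?L
    unfolding limitin_def topspace_strong_dual openin_strong_dual
  proof (intro conjI allI impI)
    fix W assume W: "strong_open smul T W \<and> 0 \<in> W"
    then obtain A e where A: "bounded_in smul T A" "e > 0"
      and AW: "{g \<in> dual_space smul T. \<forall>x\<in>A. norm (g x - 0 x) \<le> e} \<subseteq> W"
      unfolding strong_open_def by blast
    show "eventually (\<lambda>n. \<phi> n \<in> W) sequentially"
    proof (cases "A = {}")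
      case True
      then show ?thesis using AW \<phi> by (auto intro!: always_eventually)
    next
      case False
      then have "(\<lambda>n. SUP a\<in>A. ennreal (norm (\<phi> n a))) \<longlonglongrightarrow> 0" using R A(1) by blast
      then have "eventually (\<lambda>n. (SUP a\<in>A. ennreal (norm (\<phi> n a))) < ennreal e) sequentially"
        by (rule order_tendstoD) (use A(2) in simp)
      then show ?thesis
      proof eventually_elim
        case (elim n)
        have "norm (\<phi> n a - 0 a) \<le> e" if "a \<in> A" for a
        proof -
          have "ennreal (norm (\<phi> n a)) < ennreal e" using elim that by (meson SUP_upper le_less_trans)
          then show ?thesis by (simp add: ennreal_less_iff)
        qed
        then show ?case using AW \<phi> by blast
      qed
    qed
  qed (rule zero_in_dual_space)
qed

lemma bounded_sets_p_V_star_iff_p_Schur: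
  "(\<forall>A. A \<noteq> {} \<and> bounded_in smul T A \<longrightarrow> p_V_star_set p smul T A)
     \<longleftrightarrow> p_Schur p dual_smul (strong_dual smul T)"
proof -
  let ?wps = "weakly_p_summable p dual_smul (strong_dual smul T)"
  let ?lim = "\<lambda>A \<phi>. (\<lambda>n. SUP a\<in>A. ennreal (norm (\<phi> n a))) \<longlonglongrightarrow> 0"
  have "p_V_star_set p smul T A \<longleftrightarrow> (\<forall>\<phi>. ?wps \<phi> \<longrightarrow> ?lim A \<phi>)"
    if "A \<noteq> {} \<and> bounded_in smul T A" for A
    using that by (simp add: p_V_star_set_def bounded_in_def)
  then have "(\<forall>A. A \<noteq> {} \<and> bounded_in smul T A \<longrightarrow> p_V_star_set p smul T A) \<longleftrightarrow>
      (\<forall>\<phi>. ?wps \<phi> \<longrightarrow> (\<forall>A. A \<noteq> {} \<and> bounded_in smul T A \<longrightarrow> ?lim A \<phi>))"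
    by metis
  also have "\<dots> \<longleftrightarrow> (\<forall>\<phi>. ?wps \<phi> \<longrightarrow> limitin (strong_dual smul T) \<phi> 0 sequentially)"
    by (intro all_cong1 imp_cong refl limitin_strong_dual_zero_iff [symmetric])
       (simp add: weakly_p_summable_def topspace_strong_dual)
  finally show ?thesis unfolding p_Schur_def .
qed

lemma (in locally_convex_space) bounded_in_if_p_V_star_set:
  assumes "p_V_star_set p smul T A" "1 \<le> p"
  shows "bounded_in smul T A"
  using assms by (intro bounded_in_if_weakly_bounded p_V_star_set_weakly_bounded)
    (auto simp: p_V_star_set_def)

theorem theorem7p8:
  fixes smul :: "'k::real_or_complex \<Rightarrow> 'e::ab_group_add \<Rightarrow> 'e"
    and T :: "'e topology"
    and p :: ennreal
  assumes "locally_convex_space smul T"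
    and "1 \<le> p"
  shows "((\<forall>A. A \<noteq> {} \<and> bounded_in smul T A \<longrightarrow> p_V_star_set p smul T A)
            \<longleftrightarrow> p_Schur p dual_smul (strong_dual smul T))
       \<and> ({A. A \<noteq> {} \<and> bounded_in smul T A} = {A. p_V_star_set p smul T A}
            \<longleftrightarrow> p_Schur p dual_smul (strong_dual smul T))"
proof -
  have "A \<noteq> {} \<and> bounded_in smul T A" if "p_V_star_set p smul T A" for A
    using that locally_convex_space.bounded_in_if_p_V_star_set [OF assms(1) that assms(2)]
    by (auto simp: p_V_star_set_def)
  then have "{A. A \<noteq> {} \<and> bounded_in smul T A} = {A. p_V_star_set p smul T A} \<longleftrightarrow>
      (\<forall>A. A \<noteq> {} \<and> bounded_in smul T A \<longrightarrow> p_V_star_set p smul T A)"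
    by blast
  then show ?thesis
    using bounded_sets_p_V_star_iff_p_Schur [of smul T p] by simp
qed

end
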